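(* Let $p/q=[0,a_1,\ldots,a_n]$ ($n\ge 1$, $\gcd(p,q)=1$) be a continued fraction in nonalternating denominator form that has a primitive block decomposition with no exceptional primitive block, and let $\varepsilon(a_i)$ denote the crossing sign of the crossings in the twistbox $B_i$ of the corresponding oriented rational link diagram $\tilde b(q,p)$ in preferred standard form. For each $i\in\{1,\ldots,n\}$ define $$\tau(i)=i-1-\bigl|\{j\le i:\ \varepsilon(a_j)\ne\varepsilon(a_{j-1}),\ \text{or } j=1 \text{ and } a_1 \text{ is even}\}\bigr|+\sum_{\substack{j<i\\ \varepsilon(a_j)=\varepsilon(a_{j-1})=(-1)^j}}(a_j-2),$$ where conditions comparing $\varepsilon(a_j)$ with $\varepsilon(a_{j-1})$ refer to indices $j\ge2$ only (so $j=1$ is counted in the set exactly when $a_1$ is even, and $j=1$ does not occur in the sum). Then the all-even continued fraction representation of $p/q$ (the even denominator form, in which all partial denominators are even) may be obtained from $[0,a_1,\ldots,a_n]$ by replacing each $a_i$ as follows. (1) If $a_1$ is even, keep it; if $a_1$ is odd, replace it with $a_1+\operatorname{sign}(a_1)$. (2) For $i\ge2$, if $\varepsilon(a_i)\ne\varepsilon(a_{i-1})$, replace $a_i$ with $(-1)^{\tau(i)}a_i$ if $a_i$ is even and with $(-1)^{\tau(i)}(a_i+\operatorname{sign}(a_1))$ if $a_i$ is odd. (3) For $i\ge2$, if $\varepsilon(a_i)=\varepsilon(a_{i-1})=(-1)^{i-1}\operatorname{sign}(a_1)$, replace $a_i$ with $(-1)^{\tau(i)}(a_i+\operatorname{sign}(a_1))$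 if $a_i$ is odd and with $(-1)^{\tau(i)}(a_i+2\operatorname{sign}(a_1))$ if $a_i$ is even. (4) For $i\ge2$, if $\varepsilon(a_i)=\varepsilon(a_{i-1})=(-1)^{i}\operatorname{sign}(a_1)$, replace $a_i$ with the sequence $$(-1)^{\tau(i)}\operatorname{sign}(a_1)\cdot 2,\ (-1)^{\tau(i)}\operatorname{sign}(a_1)\cdot(-2),\ \ldots,\ (-1)^{\tau(i)}\operatorname{sign}(a_1)\cdot(-1)^{|a_i|-2}\cdot 2$$ of length $|a_i|-1$.
   Context: Continued fractions: $[c_0,\ldots,c_n]=c_0+\cfrac{1}{c_1+\cfrac{1}{\ddots+\cfrac{1}{c_n}}}$ with integers $c_i$. It is in nonalternating denominator form if $c_1\cdots c_n\ne0$, the integers $c_1,\ldots,c_n$ all have the same sign, and $c_0$ is zero or has that same sign. It is in even denominator form if $c_1\cdots c_n\neq 0$ and $c_0,\ldots,c_{n-1}$ are even (when $pq$ is even, $c_n$ is then also even). Primitive blocks: a contiguous subsequence $(c_m,\ldots,c_{m+2k})$ of the partial denominators of $[c_0,\ldots,c_n]$ (with $c_1\cdots c_n\ne0$) is a primitive block if (1) $k=0$ and $c_m$ is even; or (2) $k\ge1$, all of $c_m,\ldots,c_{m+2k}$ have the same sign, $c_m$ and $c_{m+2k}$ are odd, and $c_{m+2i}$ is even for $1\le i\le k-1$; or (3) $k=0$ and $m=n$. A block of type (3) whose only entry $c_n$ is odd is called exceptional. $[c_0,\ldots,c_n]$ has a primitive block decomposition if $(c_0,\ldots,c_n)$ is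 a concatenation of primitive blocks. Rational link diagrams: given nonzero integers $a_1,\ldots,a_n$ with $p/q=[0,a_1,\ldots,a_n]$, the standard diagram with vector $(a_1,\ldots,a_n)$ has four horizontal strand levels, numbered 1 (top) to 4 (bottom). At the left end, levels 1,2 are joined by an arc and levels 3,4 are joined by an arc. From left to right there are twistboxes $B_1,\ldots,B_n$; $B_i$ consists of $|a_i|$ consecutive half-twist crossings between the strands at levels 2,3 if $i$ is odd and at levels 1,2 if $i$ is even. Level 4 carries no crossings. At the right end, levels 1,2 and levels 3,4 are joined if $n$ is odd; levels 2,3 and levels 1,4 are joined if $n$ is even. Handedness: if $a_i>0$ and $i$ is odd, the crossings in $B_i$ are those which have crossing sign $+1$ when the two strands run in opposite horizontal directions (and $-1$ when they run in the same direction); if $a_i>0$ and $i$ is even, they are those which have crossing sign $-1$ when the two strands run in opposite horizontal directions (and $+1$ in the same direction); for $a_i<0$ the crossings are the mirror images. The diagram is in preferred standard form, denoted $\tilde b(q,p)$, if it is oriented so that at the left end levels 1,2,3,4 are directed right, left, right, left respectively. All crossings in one twistbox $B_i$ have the same crossing sign (usual sign of a crossing of an oriented link diagram), denoted $\varepsilon(B_i)=\varepsilon(a_i)$.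
   Formalization: In τ(i) the clause "or j=1 and a_1 is even" is dropped, and the condition in the sum reads ε(a_j)=ε(a_{j-1})=(-1)^j sign(a_1); with τ as printed the claim fails, e.g. for (a_1,a_2)=(2,4) and for (-1,-1,-1). *)

theory Defs
  imports Complex_Main
begin

section \<open>Continued fractions\<close>

text \<open>The list \<open>[c\<^sub>0, \<dots>, c\<^sub>n]\<close> stands for the continued fraction with these partial
  denominators. Division by zero yields \<open>0\<close>, but this is never used for the fractions below:
  no proper tail of a fraction in nonalternating denominator form or of a fraction with
  even partial denominators (nonzero after the first) has value \<open>0\<close>.\<close>

fun cf_value :: "int list \<Rightarrow> rat" where
  "cf_value [] = 0"
| "cf_value [c] = of_int c"
| "cf_value (c # d # cs) = of_int c + 1 / cf_value (d # cs)"

definition nonalternating_form :: "int list \<Rightarrow> bool" where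
  "nonalternating_form cs \<longleftrightarrow> cs \<noteq> [] \<and>
     (\<exists>s\<in>{1, -1}. (\<forall>c\<in>set (tl cs). sgn c = s) \<and> (hd cs = 0 \<or> sgn (hd cs) = s))"

definition even_form :: "int list \<Rightarrow> bool" where
  "even_form cs \<longleftrightarrow> cs \<noteq> [] \<and> (\<forall>c\<in>set (tl cs). c \<noteq> 0) \<and> (\<forall>c\<in>set (butlast cs). even c)"

definition all_even_representation :: "int list \<Rightarrow> rat \<Rightarrow> bool" where
  "all_even_representation cs x \<longleftrightarrow> even_form cs \<and> (\<forall>c\<in>set cs. even c) \<and> cf_value cs = x"

text \<open>A rational number has at most one such representation, which justifies the definite
  article in ``the all-even continued fraction''.\<close>

lemma even_tail_large:
  assumes "cs \<noteq> []" "\<forall>c\<in>set cs. even c \<and> c \<noteq> 0"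
  shows "\<bar>cf_value cs\<bar> > 1"
  using assms
proof (induction cs rule: cf_value.induct)
  case (2 c)
  then have "\<bar>c\<bar> > 1" by (auto elim!: evenE)
  then have "(1::rat) < of_int \<bar>c\<bar>" by (metis of_int_1 of_int_less_iff)
  then show ?case by simp
next
  case (3 c d cs)
  let ?t = "cf_value (d # cs)"
  have t: "\<bar>?t\<bar> > 1" using 3 by simp
  then have "\<bar>1 / ?t\<bar> < 1" by simp
  moreover have "\<bar>c\<bar> \<ge> 2" using 3 by (auto elim!: evenE)
  then have "(2::rat) \<le> of_int \<bar>c\<bar>" by (metis of_int_le_iff of_int_numeral)
  then have "(2::rat) \<le> \<bar>of_int c\<bar>" by simp
  ultimately have "\<bar>of_int c + 1 / ?t\<bar> > 1" by linarith
  then show ?case by simp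
qed simp

lemma even_forms_eq:
  assumes "cs \<noteq> []" "ds \<noteq> []"
    and "\<forall>c\<in>set cs. even c" "\<forall>c\<in>set (tl cs). c \<noteq> 0"
    and "\<forall>c\<in>set ds. even c" "\<forall>c\<in>set (tl ds). c \<noteq> 0"
    and "cf_value cs = cf_value ds"
  shows "cs = ds"
  using assms
proof (induction "length cs" arbitrary: cs ds)
  case (Suc l)
  have expand: "\<exists>r. cf_value xs = of_int (hd xs) + r \<and> \<bar>r\<bar> < 1 \<and>
      r = (if tl xs = [] then 0 else 1 / cf_value (tl xs)) \<and> (tl xs = [] \<longleftrightarrow> r = 0)"
    if xs: "xs \<noteq> []" "\<forall>c\<in>set xs. even c" "\<forall>c\<in>set (tl xs). c \<noteq> 0" for xs
  proof (cases "tl xs")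
    case Nil
    then show ?thesis using xs by (cases xs) auto
  next
    case (Cons y ys)
    then obtain x where x: "xs = x # y # ys" using xs by (cases xs) auto
    have "\<bar>cf_value (y # ys)\<bar> > 1"
      using xs x by (intro even_tail_large) auto
    then show ?thesis using x by auto
  qed
  obtain r where r: "cf_value cs = of_int (hd cs) + r" "\<bar>r\<bar> < 1"
      "r = (if tl cs = [] then 0 else 1 / cf_value (tl cs))" "tl cs = [] \<longleftrightarrow> r = 0"
    using expand[of cs] Suc.prems by blast
  obtain r' where r': "cf_value ds = of_int (hd ds) + r'" "\<bar>r'\<bar> < 1"
      "r' = (if tl ds = [] then 0 else 1 / cf_value (tl ds))" "tl ds = [] \<longleftrightarrow> r' = 0"
    using expand[of ds] Suc.prems by blast
  have "\<bar>of_int (hd cs - hd ds) :: rat\<bar> < 2"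
    using r(1,2) r'(1,2) Suc.prems(7) by simp
  then have "(of_int \<bar>hd cs - hd ds\<bar> :: rat) < of_int 2" by simp
  then have "\<bar>hd cs - hd ds\<bar> < 2" by (simp only: of_int_less_iff)
  moreover have "even (hd cs - hd ds)" using Suc.prems by simp
  ultimately have hd: "hd cs = hd ds" by presburger
  then have rr: "r = r'" using r(1) r'(1) Suc.prems(7) by simp
  have "tl cs = tl ds"
  proof (cases "tl cs = []")
    case True
    then show ?thesis using rr r(4) r'(4) by simp
  next
    case False
    then have ne: "tl ds \<noteq> []" using rr r(4) r'(4) by simp
    have "cf_value (tl cs) = cf_value (tl ds)" using rr r(3) r'(3) False ne by simp
    then show ?thesis
      using Suc.prems Suc.hyps(2) False ne
      by (intro Suc.hyps(1)) (auto dest: list.set_sel(2)[rotated])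
  qed
  then show ?case using hd Suc.prems(1,2) by (metis list.collapse)
qed simp

lemma all_even_representation_unique:
  assumes "all_even_representation cs x" "all_even_representation ds x"
  shows "cs = ds"
  using assms unfolding all_even_representation_def even_form_def
  by (intro even_forms_eq) auto

section \<open>Primitive blocks\<close>

text \<open>\<open>(m, k)\<close> stands for the block \<open>(c\<^sub>m, \<dots>, c\<^bsub>m+2k\<^esub>)\<close>.\<close>

definition primitive_block :: "int list \<Rightarrow> nat \<times> nat \<Rightarrow> bool" where
  "primitive_block c = (\<lambda>(m, k). m + 2 * k < length c \<and>
     (k = 0 \<and> even (c ! m) \<or>
      k \<ge> 1 \<and> (\<forall>j\<in>{m..m + 2 * k}. sgn (c ! j) = sgn (c ! m)) \<and>
        odd (c ! m) \<and> odd (c ! (m + 2 * k)) \<and> (\<forall>i\<in>{1..k - 1}. even (c ! (m + 2 * i))) \<or>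
      k = 0 \<and> m = length c - 1))"

definition exceptional_block :: "int list \<Rightarrow> nat \<times> nat \<Rightarrow> bool" where
  "exceptional_block c = (\<lambda>(m, k). k = 0 \<and> m = length c - 1 \<and> odd (c ! m))"

definition primitive_block_decomposition :: "int list \<Rightarrow> (nat \<times> nat) list \<Rightarrow> bool" where
  "primitive_block_decomposition c bs \<longleftrightarrow>
     (\<forall>b\<in>set bs. primitive_block c b) \<and>
     concat (map (\<lambda>(m, k). [m..<m + 2 * k + 1]) bs) = [0..<length c]"

section \<open>Oriented rational link diagrams\<close>

datatype direction = Leftward | Rightward

text \<open>The diagram with vector \<open>(a 1, \<dots>, a n)\<close> has twistboxes \<open>1, \<dots>, n\<close>; the crossings of
  box \<open>i\<close> lie between the levels \<open>upper_level i\<close> and \<open>upper_level i + 1\<close>.\<close>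

definition upper_level :: "nat \<Rightarrow> nat" where
  "upper_level i = (if odd i then 2 else 1)"

definition swap_levels :: "nat \<Rightarrow> nat \<Rightarrow> nat" where
  "swap_levels i l =
     (if l = upper_level i then upper_level i + 1
      else if l = upper_level i + 1 then upper_level i else l)"

text \<open>\<open>d i t l\<close> is the horizontal direction of the strand at level \<open>l\<close> in box \<open>i\<close> after the
  first \<open>t\<close> of its \<open>\<bar>a i\<bar>\<close> crossings. No strand turns around inside a twistbox; the two
  ends of an end arc have opposite horizontal directions.\<close>

definition diagram_orientation ::
    "nat \<Rightarrow> (nat \<Rightarrow> int) \<Rightarrow> (nat \<Rightarrow> nat \<Rightarrow> nat \<Rightarrow> direction) \<Rightarrow> bool" where
  "diagram_orientation n a d \<longleftrightarrow>
     d 1 0 1 \<noteq> d 1 0 2 \<and> d 1 0 3 \<noteq> d 1 0 4 \<and>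
     (\<forall>i\<in>{1..n}. \<forall>t<nat \<bar>a i\<bar>. \<forall>l\<in>{1..4}. d i (Suc t) l = d i t (swap_levels i l)) \<and>
     (\<forall>i\<in>{1..<n}. \<forall>l\<in>{1..4}. d (Suc i) 0 l = d i (nat \<bar>a i\<bar>) l) \<and>
     (let r = d n (nat \<bar>a n\<bar>) in
        if odd n then r 1 \<noteq> r 2 \<and> r 3 \<noteq> r 4 else r 2 \<noteq> r 3 \<and> r 1 \<noteq> r 4)"

definition preferred_orientation ::
    "nat \<Rightarrow> (nat \<Rightarrow> int) \<Rightarrow> (nat \<Rightarrow> nat \<Rightarrow> nat \<Rightarrow> direction) \<Rightarrow> bool" where
  "preferred_orientation n a d \<longleftrightarrow> diagram_orientation n a d \<and>
     d 1 0 1 = Rightward \<and> d 1 0 2 = Leftward \<and> d 1 0 3 = Rightward \<and> d 1 0 4 = Leftward"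

definition antiparallel_sign :: "(nat \<Rightarrow> int) \<Rightarrow> nat \<Rightarrow> int" where
  "antiparallel_sign a i = (if odd i then sgn (a i) else - sgn (a i))"

text \<open>Sign of crossing number \<open>t\<close> (counted from \<open>0\<close>) of box \<open>i\<close>.\<close>

definition crossing_sign ::
    "(nat \<Rightarrow> int) \<Rightarrow> (nat \<Rightarrow> nat \<Rightarrow> nat \<Rightarrow> direction) \<Rightarrow> nat \<Rightarrow> nat \<Rightarrow> int" where
  "crossing_sign a d i t =
     (if d i t (upper_level i) \<noteq> d i t (upper_level i + 1)
      then antiparallel_sign a i else - antiparallel_sign a i)"

definition box_sign ::
    "(nat \<Rightarrow> int) \<Rightarrow> (nat \<Rightarrow> nat \<Rightarrow> nat \<Rightarrow> direction) \<Rightarrow> nat \<Rightarrow> int" where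
  "box_sign a d i = crossing_sign a d i 0"

lemma crossing_sign_eq_box_sign:
  assumes "diagram_orientation n a d" "i \<in> {1..n}" "t < nat \<bar>a i\<bar>"
  shows "crossing_sign a d i t = box_sign a d i"
  using assms(3)
proof (induction t)
  case 0
  then show ?case by (simp add: box_sign_def)
next
  case (Suc t)
  have step: "d i (Suc t) l = d i t (swap_levels i l)" if "l \<in> {1..4}" for l
    using assms(1,2) Suc.prems that unfolding diagram_orientation_def
    by (metis Suc_lessD)
  have "d i (Suc t) (upper_level i) = d i t (upper_level i + 1)"
       "d i (Suc t) (upper_level i + 1) = d i t (upper_level i)"
    using step[of "upper_level i"] step[of "upper_level i + 1"]
    by (auto simp: swap_levels_def upper_level_def split: if_splits)
  then show ?case using Suc by (simp add: crossing_sign_def) metis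
qed

text \<open>Under the hypotheses on the continued fraction, the preferred orientation exists: along
  the boundaries of primitive blocks the levels are directed as at the left end.\<close>

fun propagated :: "int list \<Rightarrow> nat \<Rightarrow> nat \<Rightarrow> direction" where
  "propagated c 0 l = (if odd l then Rightward else Leftward)"
| "propagated c (Suc i) l =
     (if odd (c ! i) then propagated c i (swap_levels i l) else propagated c i l)"

lemma propagated_block:
  assumes b: "primitive_block c (m, k)" "\<not> exceptional_block c (m, k)"
    and start: "\<forall>l\<in>{1..4}. propagated c m l = propagated c 0 l"
    and l: "l \<in> {1..4}"
  shows "propagated c (m + 2 * k + 1) l = propagated c 0 l"
proof (cases "k = 0")
  case True
  then have "even (c ! m)"
    using b by (auto simp: primitive_block_def exceptional_block_def)
  then show ?thesis using True start l by simp
next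
  case False
  with b have odds: "odd (c ! m)" "odd (c ! (m + 2 * k))"
    and ev: "\<forall>i\<in>{1..k - 1}. even (c ! (m + 2 * i))"
    by (auto simp: primitive_block_def)
  have sw: "swap_levels i l' \<in> {1..4}" if "l' \<in> {1..4}" for i l'
    using that by (auto simp: swap_levels_def upper_level_def)
  have mid: "\<forall>l\<in>{1..4}. propagated c (m + Suc j) l = propagated c 0 (swap_levels m l)"
    if "j < 2 * k" for j
    using that
  proof (induction j)
    case 0
    show ?case using odds(1) start sw by simp
  next
    case (Suc j)
    then have IH: "\<forall>l\<in>{1..4}. propagated c (m + Suc j) l = propagated c 0 (swap_levels m l)"
      by simp
    show ?case
    proof (cases "odd j")
      case True
      then obtain h where h: "Suc j = 2 * h" by (metis even_Suc evenE)
      then have "h \<in> {1..k - 1}" using Suc.prems by auto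
      then have "even (c ! (m + Suc j))" using ev h by simp
      then show ?thesis using IH by simp
    next
      case False
      have "propagated c 0 (swap_levels m (swap_levels (m + Suc j) l'))
          = propagated c 0 (swap_levels m l')" if "l' \<in> {1..4}" for l'
        using that False by (auto simp: swap_levels_def upper_level_def)
      then show ?thesis using IH sw by simp
    qed
  qed
  have "propagated c (m + 2 * k) l' = propagated c 0 (swap_levels m l')" if "l' \<in> {1..4}" for l'
    using mid[of "2 * k - 1"] False that by simp
  moreover have "swap_levels m (swap_levels (m + 2 * k) l) = l"
    by (auto simp: swap_levels_def upper_level_def)
  ultimately show ?thesis using odds(2) sw[OF l] by simp
qed

lemma propagated_blocks:
  assumes "concat (map (\<lambda>(m, k). [m..<m + 2 * k + 1]) bs) = [m0..<N]"
    and "\<forall>b\<in>set bs. primitive_block c b \<and> \<not> exceptional_block c b"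
    and "m0 \<le> N" "\<forall>l\<in>{1..4}. propagated c m0 l = propagated c 0 l"
  shows "\<forall>l\<in>{1..4}. propagated c N l = propagated c 0 l"
  using assms
proof (induction bs arbitrary: m0)
  case Nil
  then have "length [m0..<N] = 0" by simp
  then show ?case using Nil.prems(3,4) by simp
next
  case (Cons b bs)
  obtain m k where b: "b = (m, k)" by force
  have eq: "[m..<m + 2 * k + 1] @ concat (map (\<lambda>(m, k). [m..<m + 2 * k + 1]) bs) = [m0..<N]"
    using Cons.prems(1) b by simp
  have lt: "m0 < N"
  proof (rule ccontr)
    assume "\<not> m0 < N"
    then have "[m0..<N] = []" by simp
    with eq show False by simp
  qed
  have hd: "hd [m..<m + 2 * k + 1] = m" by (rule hd_upt) simp
  have "hd ([m..<m + 2 * k + 1] @ concat (map (\<lambda>(m, k). [m..<m + 2 * k + 1]) bs)) = m"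
    using hd by (subst hd_append) auto
  then have m: "m = m0" using eq lt by (simp only: hd_upt)
  have le: "m + 2 * k + 1 \<le> N"
    using arg_cong[OF eq, of length] lt unfolding m by (simp del: upt_Suc) 
  have "concat (map (\<lambda>(m, k). [m..<m + 2 * k + 1]) bs) = drop (2 * k + 1) [m0..<N]"
    by (subst eq[symmetric]) (simp del: upt_Suc)
  also have "\<dots> = [m + 2 * k + 1..<N]" using m by (simp del: upt_Suc add: ac_simps)
  finally have rest: "concat (map (\<lambda>(m, k). [m..<m + 2 * k + 1]) bs) = [m + 2 * k + 1..<N]" .
  have "\<forall>l\<in>{1..4}. propagated c (m + 2 * k + 1) l = propagated c 0 l"
    using propagated_block[of c m k] Cons.prems(2,4) b m by simp
  then show ?case using Cons.IH[OF rest _ le] Cons.prems(2) by simp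
qed

lemma preferred_orientation_exists:
  assumes "n \<ge> 1"
    and "primitive_block_decomposition (0 # map a [1..<Suc n]) bs"
    and "\<forall>b\<in>set bs. \<not> exceptional_block (0 # map a [1..<Suc n]) b"
  shows "\<exists>d. preferred_orientation n a d"
proof -
  define c where "c = 0 # map a [1..<Suc n]"
  have c: "c ! i = a i" if "i \<in> {1..n}" for i
    using that by (cases i) (auto simp: c_def simp del: upt_Suc)
  have len: "length c = Suc n" by (simp add: c_def)
  have start: "propagated c (Suc 0) l = propagated c 0 l" for l
    by (simp add: c_def)
  have final: "\<forall>l\<in>{1..4}. propagated c (Suc n) l = propagated c 0 l"
  proof (rule propagated_blocks)
    show "concat (map (\<lambda>(m, k). [m..<m + 2 * k + 1]) bs) = [0..<Suc n]"
      using assms(2) len unfolding primitive_block_decomposition_def c_def by simp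
    show "\<forall>b\<in>set bs. primitive_block c b \<and> \<not> exceptional_block c b"
      using assms(2,3) by (simp add: primitive_block_decomposition_def c_def)
  qed auto
  define d where "d i t l = (if even t then propagated c i l else propagated c i (swap_levels i l))"
    for i t :: nat and l
  have inv: "swap_levels i (swap_levels i l) = l" for i l
    by (auto simp: swap_levels_def)
  have next_box: "d (Suc i) 0 l = d i (nat \<bar>a i\<bar>) l" if "i \<in> {1..n}" for i l
    using c[OF that] by (simp add: d_def even_nat_iff)
  have last_box: "d n (nat \<bar>a n\<bar>) l = propagated c 0 l" if "l \<in> {1..4}" for l
    using next_box[of n l] final that assms(1) by (simp add: d_def del: propagated.simps)
  have left: "d 1 0 l = propagated c 0 l" for l
    using start by (simp add: d_def del: propagated.simps)
  have cross: "d i (Suc t) l = d i t (swap_levels i l)" for i t l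
    by (simp add: d_def inv)
  have "preferred_orientation n a d"
    unfolding preferred_orientation_def diagram_orientation_def Let_def
    using next_box by (simp add: left last_box cross del: propagated.simps(2) One_nat_def)
  then show ?thesis by blast
qed

section \<open>The replacement rules\<close>

text \<open>The exponent is negative in some cases, hence an integer; only its parity matters.\<close>

definition parity_sign :: "int \<Rightarrow> int" where
  "parity_sign k = (if even k then 1 else -1)"

text \<open>The source defines \<open>\<tau>(i)\<close> as in \<open>tau_printed\<close>. With this exponent the result is false;
  see \<open>printed_fails_even\<close> and \<open>printed_fails_negative\<close>. The definition \<open>tau\<close> makes two
  corrections: the index \<open>1\<close> is never counted in the set, and the condition in the sum is
  \<open>\<epsilon>(a\<^sub>j) = \<epsilon>(a\<^bsub>j-1\<^esub>) = (-1)\<^sup>j sign(a\<^sub>1)\<close> (the condition of rule 4) instead of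
  \<open>\<epsilon>(a\<^sub>j) = \<epsilon>(a\<^bsub>j-1\<^esub>) = (-1)\<^sup>j\<close>. The two exponents agree if \<open>a\<^sub>1\<close> is positive and odd.\<close>

definition tau_printed :: "(nat \<Rightarrow> int) \<Rightarrow> (nat \<Rightarrow> int) \<Rightarrow> nat \<Rightarrow> int" where
  "tau_printed a \<epsilon> i = int i - 1
     - int (card {j \<in> {1..i}. j \<ge> 2 \<and> \<epsilon> j \<noteq> \<epsilon> (j - 1) \<or> j = 1 \<and> even (a 1)})
     + (\<Sum>j\<in>{j \<in> {2..<i}. \<epsilon> j = \<epsilon> (j - 1) \<and> \<epsilon> (j - 1) = (-1) ^ j}. a j - 2)"

definition tau :: "(nat \<Rightarrow> int) \<Rightarrow> (nat \<Rightarrow> int) \<Rightarrow> nat \<Rightarrow> int" where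
  "tau a \<epsilon> i = int i - 1
     - int (card {j \<in> {1..i}. j \<ge> 2 \<and> \<epsilon> j \<noteq> \<epsilon> (j - 1)})
     + (\<Sum>j\<in>{j \<in> {2..<i}. \<epsilon> j = \<epsilon> (j - 1) \<and> \<epsilon> (j - 1) = (-1) ^ j * sgn (a 1)}. a j - 2)"

text \<open>The integers that replace \<open>a i\<close>, for vector \<open>a\<close>, signs \<open>\<epsilon>\<close> and exponents \<open>\<tau>\<close>. As all signs
  are \<open>1\<close> or \<open>-1\<close>, the last case is \<open>\<epsilon> i = \<epsilon> (i - 1) = (-1) ^ i * sgn (a 1)\<close>.\<close>

definition replacement ::
    "(nat \<Rightarrow> int) \<Rightarrow> (nat \<Rightarrow> int) \<Rightarrow> (nat \<Rightarrow> int) \<Rightarrow> nat \<Rightarrow> int list" where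
  "replacement a \<epsilon> \<tau> i =
     (let s = sgn (a 1) in
      if i = 1 then [if even (a 1) then a 1 else a 1 + s]
      else if \<epsilon> i \<noteq> \<epsilon> (i - 1) then
        [parity_sign (\<tau> i) * (if even (a i) then a i else a i + s)]
      else if \<epsilon> i = (-1) ^ (i - 1) * s then
        [parity_sign (\<tau> i) * (if odd (a i) then a i + s else a i + 2 * s)]
      else map (\<lambda>r. parity_sign (\<tau> i) * s * ((-1) ^ r * 2)) [0..<nat \<bar>a i\<bar> - 1])"

text \<open>For the vector \<open>(2, 4)\<close> the printed exponent fails whatever the crossing signs are.\<close>

lemma printed_fails_even:
  fixes a \<epsilon> :: "nat \<Rightarrow> int"
  assumes a: "a 1 = 2" "a 2 = 4"
  shows "cf_value (0 # concat (map (replacement a \<epsilon> (tau_printed a \<epsilon>)) [1..<Suc 2]))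
           \<noteq> cf_value (0 # map a [1..<Suc 2])"
proof -
  have upt: "[1..<Suc 2] = [1, 2]" "[0..<3] = [0, 1, 2]"
    by (simp_all add: numeral_eq_Suc)
  have one: "replacement a \<epsilon> (tau_printed a \<epsilon>) 1 = [2]"
    using a by (simp add: replacement_def)
  show ?thesis
  proof (cases "\<epsilon> 2 = \<epsilon> 1")
    case False
    have "{j \<in> {1..2}. j \<ge> 2 \<and> \<epsilon> j \<noteq> \<epsilon> (j - 1) \<or> j = 1 \<and> even (a 1)} = {1, 2::nat}"
      using a False by (auto simp: le_Suc_eq numeral_2_eq_2)
    then have "tau_printed a \<epsilon> 2 = -1" by (simp add: tau_printed_def)
    then have "replacement a \<epsilon> (tau_printed a \<epsilon>) 2 = [-4]"
      using a False by (simp add: replacement_def parity_sign_def)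
    then show ?thesis using a one unfolding upt by simp
  next
    case True
    define u where "u = parity_sign (tau_printed a \<epsilon> 2)"
    have u: "u = 1 \<or> u = -1" by (simp add: u_def parity_sign_def)
    have "replacement a \<epsilon> (tau_printed a \<epsilon>) 2
        = (if \<epsilon> 2 = - 1 then [u * 6] else [u * 2, u * (- 2), u * 2])"
      using a True upt(2) by (simp add: replacement_def u_def)
    then show ?thesis using a one u unfolding upt by auto
  qed
qed

text \<open>For the vector \<open>(-1, -1, -1)\<close>, which is a primitive block, it fails as well.\<close>

lemma printed_fails_negative:
  fixes a :: "nat \<Rightarrow> int"
  assumes "preferred_orientation 3 a d"
    and a: "\<And>i. a i = - 1"
  defines "\<epsilon> \<equiv> box_sign a d"
  shows "cf_value (0 # concat (map (replacement a \<epsilon> (tau_printed a \<epsilon>)) [1..<Suc 3]))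
           \<noteq> cf_value (0 # map a [1..<Suc 3])"
proof -
  have d1: "d 1 0 1 = Rightward" "d 1 0 2 = Leftward" "d 1 0 3 = Rightward" "d 1 0 4 = Leftward"
    and cross: "\<forall>i\<in>{1..3}. \<forall>l\<in>{1..4}. d i 1 l = d i 0 (swap_levels i l)"
    and nxt: "\<forall>i\<in>{1..<3}. \<forall>l\<in>{1..4}. d (Suc i) 0 l = d i 1 l"
    using assms(1) unfolding preferred_orientation_def diagram_orientation_def
    by (auto simp: a)
  have d2: "d 2 0 l = d 1 0 (swap_levels 1 l)" if "l \<in> {1..4}" for l
    using cross nxt that by (force simp: numeral_2_eq_2)
  have d3: "d 3 0 l = d 1 0 (swap_levels 1 (swap_levels 2 l))" if "l \<in> {1..4}" for l
  proof -
    have "swap_levels 2 l \<in> {1..4}" using that by (auto simp: swap_levels_def upper_level_def)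
    moreover have "d 3 0 l = d 2 1 l" using nxt[rule_format, of 2 l] that by simp
    moreover have "d 2 1 l = d 2 0 (swap_levels 2 l)" using cross that by simp
    ultimately show ?thesis using d2 by simp
  qed
  have e: "\<epsilon> 1 = -1" "\<epsilon> 2 = -1" "\<epsilon> 3 = -1"
    using d1 by (auto simp: \<epsilon>_def box_sign_def crossing_sign_def antiparallel_sign_def
        upper_level_def swap_levels_def a d2 d3 simp del: One_nat_def)
  have upt: "[1..<Suc 3] = [1, 2, 3]" by (simp add: numeral_eq_Suc)
  have "{j \<in> {1..3}. j \<ge> 2 \<and> \<epsilon> j \<noteq> \<epsilon> (j - 1) \<or> j = 1 \<and> even (a 1)} = {}"
    using e by (auto simp: a le_Suc_eq numeral_eq_Suc)
  moreover have "{j \<in> {2..<3::nat}. \<epsilon> j = \<epsilon> (j - 1) \<and> \<epsilon> (j - 1) = (-1) ^ j} = {}"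
    using e by (auto simp: less_Suc_eq numeral_eq_Suc)
  ultimately have "tau_printed a \<epsilon> 3 = 2"
    unfolding tau_printed_def by (simp only: card.empty sum.empty)
  then have "replacement a \<epsilon> (tau_printed a \<epsilon>) 1 = [-2]"
    "replacement a \<epsilon> (tau_printed a \<epsilon>) 2 = []"
    "replacement a \<epsilon> (tau_printed a \<epsilon>) 3 = [-2]"
    using e by (simp_all add: replacement_def parity_sign_def a)
  then show ?thesis unfolding upt by (simp add: a)
qed

end

(* Call a twistbox parallel if its two strands run in the same direction. Following the directions
   from left to right, parallel boxes are isolated, neither the first nor the last box is parallel,
   and an antiparallel box i is preceded and followed by u(i), v(i) in {0, 1} parallel boxes, where
   u(i) + v(i) and a(i) have the same parity. In these terms rules (1)-(3) say that an antiparallel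
   a(i) becomes, up to sign, a(i) + (u(i) + v(i)) sign(a(1)), and rule (4) applies exactly to the
   parallel boxes. So the result follows from the identity
     x + 1/(b + 1/y) = (x + 1) + 1/[-2, 2, ..., (-1)^(b-1) 2, (-1)^b (y + 1)]
   applied at every parallel box; the exponent tau records the signs that this produces. *)

theory Submission
  imports Defs
begin

section \<open>Continued fractions that begin with an alternating run of 2 and -2\<close>

text \<open>For \<open>cs = []\<close> this uses \<open>1 / 0 = 0\<close>.\<close>

lemma cf_value_Cons: "cf_value (c # cs) = of_int c + 1 / cf_value cs"
  by (cases cs) auto

text \<open>Peeling off the first entry replaces \<open>g\<close> by \<open>- g\<close>. With D = ky
  + 1, the induction step is the identity 2 - 1/(1 + y/D) = 1 + y/(D + y).\<close>

lemma cf_value_alternating_append: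
  fixes y :: rat and g :: int
  assumes "y > 0" and "g = 1 \<or> g = -1"
    and "cf_value cs = of_int (g * (-1) ^ k) * (y + 1)"
  shows "cf_value (map (\<lambda>r. g * ((-1) ^ r * 2)) [0..<k] @ cs)
           = of_int g * (1 + y / (of_nat k * y + 1))"
  using assms(2,3)
proof (induction k arbitrary: g)
  case 0
  then show ?case by simp
next
  case (Suc k)
  let ?D = "of_nat k * y + 1"
  have D: "?D > 0" using assms(1) by (simp add: add_nonneg_pos)
  have list: "map (\<lambda>r. g * ((-1) ^ r * 2)) [0..<Suc k]
      = 2 * g # map (\<lambda>r. - g * ((-1) ^ r * 2)) [0..<k]"
    by (simp add: upt_conv_Cons map_Suc_upt[symmetric] del: upt_Suc)
  have IH: "cf_value (map (\<lambda>r. - g * ((-1) ^ r * 2)) [0..<k] @ cs)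
      = of_int (- g) * (1 + y / ?D)"
    using Suc.prems by (intro Suc.IH) auto
  have "of_nat (Suc k) * y + 1 = ?D + y" by (simp add: algebra_simps)
  moreover have "2 - 1 / (1 + y / ?D) = 1 + y / (?D + y)"
    using D assms(1) by (simp add: field_simps)
  moreover have "of_int (2 * g) + 1 / (of_int (- g) * x) = of_int g * (2 - 1 / x)" for x :: rat
    using Suc.prems(1) by auto
  ultimately show ?case
    unfolding list append_Cons cf_value_Cons IH by (simp only:)
qed

section \<open>Strand directions and parallel boxes\<close>

lemma propagated_0_swap_levels:
  "propagated c 0 (swap_levels i (upper_level i)) \<noteq> propagated c 0 (upper_level i)"
  by (simp add: swap_levels_def upper_level_def)

text \<open>Using \<open>propagated\<close> instead of an orientation \<open>d\<close> gives the
  notion a meaning also at the fictitious boxes 0 and n + 1.\<close>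

definition parallel_box :: "int list \<Rightarrow> nat \<Rightarrow> bool" where
  "parallel_box c i \<longleftrightarrow>
     propagated c i (upper_level i) = propagated c i (upper_level i + 1)"

text \<open>At the left end of box \<open>i\<close> the strands are directed as at the left end of the diagram, up
  to a swap of two neighbouring levels: those of the boxes \<open>i \<plusminus> 1\<close> if box \<open>i\<close> is parallel, and
  those of box \<open>i\<close> itself if box \<open>i - 1\<close> is parallel.\<close>

definition phase :: "bool \<Rightarrow> bool \<Rightarrow> nat \<Rightarrow> nat \<Rightarrow> nat" where
  "phase p r i l = (if p then swap_levels (Suc i) l else if r then swap_levels i l else l)"

text \<open>Directions alternate at the left end of the diagram. Swapping the levels of box
  \<open>i\<close> keeps its strands opposite; swapping the neighbouring pair, which shares level 2
  with it, makes them agree.\<close>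

lemma parallel_box_phase:
  assumes "\<And>l. l \<in> {1..4} \<Longrightarrow> propagated c i l = propagated c 0 (phase p r i l)"
  shows "parallel_box c i \<longleftrightarrow> p"
proof -
  have "upper_level i \<in> {1..4}" "upper_level i + 1 \<in> {1..4}"
    by (auto simp: upper_level_def)
  then show ?thesis
    unfolding parallel_box_def
    by (simp only: assms) (auto simp: phase_def swap_levels_def upper_level_def)
qed

text \<open>A parallel box exchanges equally directed strands, so directions do not change and the
  swap present is that of the next box's own levels. In an antiparallel box an odd number of
  crossings toggles the swap of its own levels, and a swap left over makes the next box
  parallel.\<close>

lemma propagated_phase_Suc:
  assumes "\<And>l. l \<in> {1..4} \<Longrightarrow> propagated c i l = propagated c 0 (phase p r i l)"
    and l: "l \<in> {1..4}"
  shows "propagated c (Suc i) l =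
    propagated c 0 (phase (\<not> p \<and> r \<noteq> odd (c ! i)) p (Suc i) l)"
proof -
  have "propagated c (Suc i) l = propagated c i (if odd (c ! i) then swap_levels i l else l)"
    by simp
  also have "\<dots> = propagated c 0 (phase p r i (if odd (c ! i) then swap_levels i l else l))"
    using l by (intro assms(1)) (auto simp: swap_levels_def upper_level_def)
  also have "\<dots> = propagated c 0 (phase (\<not> p \<and> r \<noteq> odd (c ! i)) p (Suc i) l)"
  proof -
    have "l = 1 \<or> l = 2 \<or> l = 3 \<or> l = 4" using l by auto
    then show ?thesis
      by (elim disjE) (auto simp: phase_def swap_levels_def upper_level_def)
  qed
  finally show ?thesis .
qed

lemma propagated_phase:
  assumes "even (c ! 0)" and "i \<ge> 1" and "l \<in> {1..4}"
  shows "propagated c i l =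
    propagated c 0 (phase (parallel_box c i) (parallel_box c (i - 1)) i l)"
  using assms(2,3)
proof (induction i arbitrary: l rule: dec_induct)
  case base
  show ?case using assms(1)
    by (auto simp: parallel_box_def upper_level_def swap_levels_def phase_def)
next
  case (step i)
  note next_level = propagated_phase_Suc[OF step.IH]
  \<comment> \<open>By \<open>parallel_box_phase\<close> the flag computed for the next box is
    \<open>parallel_box c (Suc i)\<close> itself, so the invariant keeps its form.\<close>
  show ?case
    using next_level[of l] parallel_box_phase[OF next_level] step.prems
    by (simp del: propagated.simps)
qed

lemma parallel_box_Suc:
  assumes "even (c ! 0)" and "i \<ge> 1"
  shows "parallel_box c (Suc i) \<longleftrightarrow>
    \<not> parallel_box c i \<and> parallel_box c (i - 1) \<noteq> odd (c ! i)"
  by (rule parallel_box_phase[OF propagated_phase_Suc[OF propagated_phase[OF assms]]])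

section \<open>The replacement rules in terms of parallel boxes\<close>

text \<open>\<open>P i\<close> says that box \<open>i\<close> is parallel; at the fictitious indices \<open>0\<close> and \<open>n + 1\<close> it is false.\<close>

locale oriented_vector =
  fixes n :: nat and a \<epsilon> :: "nat \<Rightarrow> int" and s :: int and P :: "nat \<Rightarrow> bool"
  assumes n: "n \<ge> 1"
    and s: "s = 1 \<or> s = -1"
    and sgn_a: "i \<in> {1..n} \<Longrightarrow> sgn (a i) = s"
    and sign: "i \<in> {1..n} \<Longrightarrow> \<epsilon> i = s * (-1) ^ (if P i then i else Suc i)"
    and P_ends: "\<not> P 0" "\<not> P 1" "\<not> P n" "\<not> P (Suc n)"
    and P_Suc: "i \<in> {1..n} \<Longrightarrow> P (Suc i) \<longleftrightarrow> \<not> P i \<and> P (i - 1) \<noteq> odd (a i)"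
begin

abbreviation \<sigma> :: "nat \<Rightarrow> int" where
  "\<sigma> i \<equiv> parity_sign (tau a \<epsilon> i)"

abbreviation tail :: "nat \<Rightarrow> int list" where
  "tail i \<equiv> concat (map (replacement a \<epsilon> (tau a \<epsilon>)) [i..<Suc n])"

lemma sgn_a_1: "sgn (a 1) = s"
  using sgn_a n by simp

lemma a_eq: "i \<in> {1..n} \<Longrightarrow> a i = s * \<bar>a i\<bar>"
  using sgn_a[of i] by (metis abs_sgn mult.commute mult_sgn_abs)

lemma abs_a_pos: "i \<in> {1..n} \<Longrightarrow> \<bar>a i\<bar> \<ge> 1"
  using sgn_a[of i] s by (cases "a i = 0") auto

text \<open>As all \<open>a i\<close> have one sign, the signs of antiparallel boxes would alternate
  with the index; being parallel flips a sign.\<close>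

lemma \<epsilon>_Suc_eq_iff:
  assumes "i \<in> {1..<n}"
  shows "\<epsilon> (Suc i) = \<epsilon> i \<longleftrightarrow> P (Suc i) \<noteq> P i"
  using assms s by (auto simp: sign)

lemma \<epsilon>_eq_iff:
  assumes "i \<in> {1..n}"
  shows "\<epsilon> i = (-1) ^ i * s \<longleftrightarrow> P i" and "\<epsilon> i = (-1) ^ (i - 1) * s \<longleftrightarrow> \<not> P i"
  using assms s by (cases i; auto simp: sign)+

lemma \<sigma>_cases: "\<sigma> i = 1 \<or> \<sigma> i = -1"
  by (simp add: parity_sign_def)

lemma \<sigma>_1: "\<sigma> 1 = 1"
proof -
  have "{j \<in> {1..1::nat}. j \<ge> 2 \<and> \<epsilon> j \<noteq> \<epsilon> (j - 1)} = {}" by auto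
  moreover have "{j \<in> {2..<1::nat}. \<epsilon> j = \<epsilon> (j - 1) \<and> \<epsilon> (j - 1) = (-1) ^ j * sgn (a 1)} = {}"
    by auto
  ultimately show ?thesis
    unfolding tau_def parity_sign_def by (simp only:) simp
qed

text \<open>These are the sign changes in the identity for a parallel box: entering its run flips
  the sign, and leaving it contributes one flip for each of its
  \<open>nat \<bar>a i\<bar> - 1\<close> entries.\<close>

lemma \<sigma>_Suc:
  assumes i: "i \<in> {1..<n}"
  shows "\<sigma> (Suc i) = (if P (Suc i) then - \<sigma> i
           else if P i then \<sigma> i * (-1) ^ (nat \<bar>a i\<bar> - 1) else \<sigma> i)"
proof -
  let ?E = "\<lambda>j. j \<ge> 2 \<and> \<epsilon> j \<noteq> \<epsilon> (j - 1)"
  let ?F = "\<lambda>j. \<epsilon> j = \<epsilon> (j - 1) \<and> \<epsilon> (j - 1) = (-1) ^ j * sgn (a 1)"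
  have "{j \<in> {1..Suc i}. ?E j} = (if ?E (Suc i) then insert (Suc i) {j \<in> {1..i}. ?E j}
      else {j \<in> {1..i}. ?E j})"
    by (auto simp: le_Suc_eq)
  then have card: "int (card {j \<in> {1..Suc i}. ?E j})
      = int (card {j \<in> {1..i}. ?E j}) + of_bool (?E (Suc i))"
    by simp
  have "{j \<in> {2..<Suc i}. ?F j} = (if i \<ge> 2 \<and> ?F i then insert i {j \<in> {2..<i}. ?F j}
      else {j \<in> {2..<i}. ?F j})"
    by (auto simp: less_Suc_eq)
  then have sum: "(\<Sum>j\<in>{j \<in> {2..<Suc i}. ?F j}. a j - 2)
      = (\<Sum>j\<in>{j \<in> {2..<i}. ?F j}. a j - 2) + (if i \<ge> 2 \<and> ?F i then a i - 2 else 0)"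
    by simp
  have E: "?E (Suc i) \<longleftrightarrow> P (Suc i) = P i"
    using \<epsilon>_Suc_eq_iff[OF i] i by auto
  \<comment> \<open>The sum ranges over the parallel boxes: such a box is not the first, and the box
    before it is antiparallel, so the two signs agree.\<close>
  have F: "i \<ge> 2 \<and> ?F i \<longleftrightarrow> P i"
  proof (cases "i = 1")
    case True
    then show ?thesis using P_ends by simp
  next
    case False
    then obtain j where j: "i = Suc j" "j \<in> {1..<n}" using i by (cases i) auto
    then have "P i \<Longrightarrow> \<not> P j" using P_Suc[of j] by auto
    then show ?thesis
      using \<epsilon>_Suc_eq_iff[OF j(2)] \<epsilon>_eq_iff(1)[of i] i j by (auto simp: sgn_a_1[simplified])
  qed
  have "tau a \<epsilon> (Suc i) = tau a \<epsilon> i + 1 - of_bool (P (Suc i) = P i) + (if P i then a i - 2 else 0)"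
    unfolding tau_def card sum E F by simp
  moreover have "P i \<Longrightarrow> \<not> P (Suc i)" using P_Suc[of i] i by auto
  moreover have "even (nat \<bar>a i\<bar> - 1) \<longleftrightarrow> odd (a i)"
    using abs_a_pos[of i] i by (auto simp: even_diff_nat even_nat_iff)
  ultimately show ?thesis
    by (auto simp: parity_sign_def uminus_power_if)
qed

text \<open>For an antiparallel box after the first, a sign change means that the box before is
  antiparallel too (rule 2), no change that it is parallel (rule 3). The parity of
  \<open>a i\<close> then tells by \<open>P_Suc\<close> whether the box after is parallel.\<close>

lemma replacement_eq:
  assumes i: "i \<in> {1..n}"
  shows "replacement a \<epsilon> (tau a \<epsilon>) i =
    (if P i then map (\<lambda>r. \<sigma> i * s * ((-1) ^ r * 2)) [0..<nat \<bar>a i\<bar> - 1]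
     else [\<sigma> i * (a i + (of_bool (P (i - 1)) + of_bool (P (Suc i))) * s)])"
proof (cases "i = 1")
  case True
  \<comment> \<open>Box 0 counts as antiparallel, so rule (1) has the shape of rule (2).\<close>
  then show ?thesis
    using P_Suc[of 1] P_ends n \<sigma>_1 by (simp add: replacement_def sgn_a_1[simplified])
next
  case False
  then obtain j where j: "i = Suc j" "j \<in> {1..<n}" using i by (cases i) auto
  have "P i \<Longrightarrow> \<not> P j" using P_Suc[of j] j by auto
  then show ?thesis
    using False j \<epsilon>_Suc_eq_iff[OF j(2)] \<epsilon>_eq_iff(2)[of i] P_Suc[of i] i
    by (auto simp: replacement_def sgn_a_1[simplified] Let_def)
qed

section \<open>Values of the tails of both fractions\<close>

lemma tail_eq_append: "i \<in> {1..n} \<Longrightarrow> tail i = replacement a \<epsilon> (tau a \<epsilon>) i @ tail (Suc i)"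
  by (simp add: upt_conv_Cons del: upt_Suc)

text \<open>The factor \<open>s\<close> makes all tails of the given fraction positive, so that both
  signs are treated at once.\<close>

definition V :: "nat \<Rightarrow> rat" where
  "V i = of_int s * cf_value (map a [i..<Suc n])"

lemma V_n: "V n = of_int \<bar>a n\<bar>"
  using a_eq[of n] n s by (auto simp: V_def)

lemma V_rec:
  assumes "i \<in> {1..n}"
  shows "V i = of_int \<bar>a i\<bar> + 1 / V (Suc i)"
proof -
  have "V i = of_int (s * a i) + of_int s / cf_value (map a [Suc i..<Suc n])"
    unfolding V_def using assms
    by (simp add: upt_conv_Cons cf_value_Cons ring_distribs del: upt_Suc)
  moreover have "s * a i = \<bar>a i\<bar>" using a_eq[OF assms] s by auto
  ultimately show ?thesis using s by (auto simp: V_def simp del: upt_Suc)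
qed

lemma V_pos: "i \<in> {1..n} \<Longrightarrow> V i > 0"
proof (induction "n - i" arbitrary: i)
  case 0
  then have "i = n" by simp
  then show ?case using V_n abs_a_pos[of n] n by simp
next
  case (Suc k)
  then have "V (Suc i) > 0" by simp
  then show ?case using V_rec[of i] abs_a_pos[of i] Suc.prems by (simp add: add_pos_pos)
qed

text \<open>This keeps the denominator \<open>V i - 1\<close> at a parallel box nonzero. The last
  tail may equal 1, but the last box is never parallel.\<close>

lemma V_gt_1:
  assumes "i \<in> {1..<n}"
  shows "V i > 1"
proof -
  have "(1::rat) \<le> of_int \<bar>a i\<bar>" using abs_a_pos[of i] assms by simp
  moreover have "1 / V (Suc i) > 0" using V_pos[of "Suc i"] assms by simp
  moreover have "V i = of_int \<bar>a i\<bar> + 1 / V (Suc i)" using V_rec[of i] assms by simp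
  ultimately show ?thesis by linarith
qed

text \<open>Induction from the right end. The summand 1 is the amount by which a parallel box before
  \<open>i\<close> raises the entry; the quotient is the value that
  \<open>cf_value_alternating_append\<close> yields for a run.\<close>

lemma cf_value_tail:
  assumes "i \<in> {1..n}"
  shows "cf_value (tail i) = of_int (\<sigma> i * s) *
    (if P i then V i / (V i - 1) else V i + of_bool (P (i - 1)))"
  using assms
proof (induction "n - i" arbitrary: i)
  case 0
  then have "i = n" by simp
  moreover have "a n + of_bool (P (n - 1)) * s = s * (\<bar>a n\<bar> + of_bool (P (n - 1)))"
    using n by (subst a_eq) (simp_all add: algebra_simps)
  ultimately show ?case
    using replacement_eq[of n] P_ends V_n n by simp
next
  case (Suc k)
  then have i: "i \<in> {1..<n}" by auto
  then have i': "i \<in> {1..n}" by auto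
  have IH: "cf_value (tail (Suc i)) = of_int (\<sigma> (Suc i) * s) *
      (if P (Suc i) then V (Suc i) / (V (Suc i) - 1) else V (Suc i) + of_bool (P i))"
    using Suc.hyps(1)[of "Suc i"] Suc.hyps(2) i by auto
  define y where "y = V (Suc i)"
  have y: "y > 0" using V_pos[of "Suc i"] i by (simp add: y_def)
  have Vi: "V i = of_int \<bar>a i\<bar> + 1 / y" using V_rec[OF i'] by (simp add: y_def)
  have ss: "s * s = 1" using s by auto
  have \<sigma>\<sigma>: "\<sigma> i * \<sigma> i = 1" using \<sigma>_cases[of i] by auto
  show ?case
  proof (cases "P i")
    case True
    define k where "k = nat \<bar>a i\<bar> - 1"
    have k: "(of_int \<bar>a i\<bar> :: rat) = of_nat k + 1"
      using abs_a_pos[OF i'] by (simp add: k_def of_nat_diff)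
    have P': "\<not> P (Suc i)" using True P_Suc[OF i'] by simp
    \<comment> \<open>The rest after the run has value \<open>\<sigma> (Suc i) * s\<close> times y +
      1, and \<open>\<sigma> (Suc i)\<close> is \<open>\<sigma> i * (-1) ^ k\<close>. The run is
      empty if \<open>\<bar>a i\<bar> = 1\<close>.\<close>
    have "cf_value (tail i) = of_int (\<sigma> i * s) * (1 + y / (of_nat k * y + 1))"
      unfolding tail_eq_append[OF i'] replacement_eq[OF i'] if_P[OF True] k_def[symmetric]
      using y \<sigma>_cases[of i] s P' True IH \<sigma>_Suc[OF i]
      by (intro cf_value_alternating_append) (auto simp: y_def k_def)
    moreover have "1 + y / (of_nat k * y + 1) = V i / (V i - 1)"
    proof -
      let ?D = "of_nat k * y + 1"
      have D: "?D > 0" using y by (simp add: add_nonneg_pos)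
      have "V i = (?D + y) / y" and "V i - 1 = ?D / y"
        using y unfolding Vi k by (simp_all add: field_simps)
      then have "V i / (V i - 1) = (?D + y) / ?D" using y by (simp only:) simp
      also have "\<dots> = 1 + y / ?D" using D by (simp add: add_divide_distrib)
      finally show ?thesis by simp
    qed
    ultimately show ?thesis using True by simp
  next
    case False
    have "cf_value (tail i) = of_int (\<sigma> i * (a i + (of_bool (P (i - 1)) + of_bool (P (Suc i))) * s))
        + 1 / cf_value (tail (Suc i))"
      unfolding tail_eq_append[OF i'] replacement_eq[OF i'] using False
      by (simp add: cf_value_Cons del: upt_Suc)
    also have "a i + (of_bool (P (i - 1)) + of_bool (P (Suc i))) * s
        = s * (\<bar>a i\<bar> + of_bool (P (i - 1)) + of_bool (P (Suc i)))"
      by (subst a_eq[OF i']) (simp add: algebra_simps)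
    \<comment> \<open>A parallel next box carries the sign \<open>- \<sigma> i\<close>, so its
      reciprocal enters as -(y - 1)/y = 1/y - 1. This cancels the 1 by which that box raises the
      present entry.\<close>
    also have "1 / cf_value (tail (Suc i)) = of_int (\<sigma> i * s) * (1 / y - of_bool (P (Suc i)))"
    proof (cases "P (Suc i)")
      case True
      then have "Suc i \<in> {1..<n}" using i P_ends by (cases "Suc i = n") auto
      then have "y > 1" using V_gt_1 by (simp add: y_def)
      then show ?thesis
        using True IH \<sigma>_Suc[OF i] \<sigma>_cases[of i] s
        by (auto simp: y_def[symmetric] diff_divide_distrib simp del: upt_Suc)
    next
      case P': False
      then show ?thesis
        using False IH \<sigma>_Suc[OF i] \<sigma>_cases[of i] s
        by (auto simp: y_def[symmetric] simp del: upt_Suc)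
    qed
    finally show ?thesis using False by (simp add: Vi algebra_simps del: upt_Suc)
  qed
qed

text \<open>At an antiparallel box, evenness is the parity law \<open>P_Suc\<close>, and the entry
  is nonzero because the correction never has the sign opposite to \<open>a i\<close>.\<close>

lemma even_nonzero_replacement:
  assumes i: "i \<in> {1..n}" and "c \<in> set (replacement a \<epsilon> (tau a \<epsilon>) i)"
  shows "even c \<and> c \<noteq> 0"
proof (cases "P i")
  case True
  then show ?thesis
    using assms(2) \<sigma>_cases[of i] s unfolding replacement_eq[OF i] by auto
next
  case False
  then have c: "c = \<sigma> i * (a i + (of_bool (P (i - 1)) + of_bool (P (Suc i))) * s)"
    using assms(2) unfolding replacement_eq[OF i] by simp
  have "a i + (of_bool (P (i - 1)) + of_bool (P (Suc i))) * s
      = s * (\<bar>a i\<bar> + of_bool (P (i - 1)) + of_bool (P (Suc i)))"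
    by (subst a_eq[OF i]) (simp add: algebra_simps)
  then show ?thesis
    using P_Suc[OF i] False abs_a_pos[OF i] \<sigma>_cases[of i] s unfolding c by auto
qed

lemma all_even_representation_tail:
  "all_even_representation (0 # tail 1) (cf_value (0 # map a [1..<Suc n]))"
proof -
  have ev: "even c \<and> c \<noteq> 0" if "c \<in> set (tail 1)" for c
    using that by (auto simp del: upt_Suc dest!: even_nonzero_replacement[rotated])
  \<comment> \<open>Boxes 0 and 1 are not parallel, so neither the quotient nor the summand 1 occurs
    at the start.\<close>
  have "cf_value (tail 1) = of_int s * V 1"
    using cf_value_tail[of 1] \<sigma>_1 P_ends n by (simp del: upt_Suc)
  also have "\<dots> = cf_value (map a [1..<Suc n])"
    using s by (auto simp: V_def simp del: upt_Suc)
  finally have "cf_value (0 # tail 1) = cf_value (0 # map a [1..<Suc n])"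
    by (simp only: cf_value_Cons)
  moreover have "even c" if "c \<in> set (butlast (0 # tail 1))" for c
    using in_set_butlastD[OF that] ev by (auto simp del: upt_Suc)
  ultimately show ?thesis
    using ev unfolding all_even_representation_def even_form_def by (simp del: upt_Suc)
qed

end

section \<open>From the oriented diagram to the abstract setting\<close>

lemma orientation_in_box:
  assumes "diagram_orientation n a d" and i: "i \<in> {1..n}"
    and "t \<le> nat \<bar>a i\<bar>" and "l \<in> {1..4}"
  shows "d i t l = d i 0 (if even t then l else swap_levels i l)"
  using assms(3,4)
proof (induction t arbitrary: l)
  case (Suc t)
  have "d i (Suc t) l = d i t (swap_levels i l)"
    using assms(1) i Suc.prems unfolding diagram_orientation_def by auto
  moreover have "swap_levels i l \<in> {1..4}" "swap_levels i (swap_levels i l) = l"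
    using Suc.prems(2) by (auto simp: swap_levels_def upper_level_def)
  ultimately show ?case using Suc by auto
qed simp

text \<open>The directions at the left end force all others, and a box acts on them only through the
  parity of its number of crossings.\<close>

lemma preferred_orientation_eq_propagated:
  assumes "preferred_orientation n a d"
    and "even (c ! 0)" and c: "\<And>i. i \<in> {1..n} \<Longrightarrow> c ! i = a i"
    and "i \<ge> 1" and "i \<le> n" and "l \<in> {1..4}"
  shows "d i 0 l = propagated c i l"
  using assms(4-)
proof (induction i arbitrary: l rule: dec_induct)
  case base
  then have "l = 1 \<or> l = 2 \<or> l = 3 \<or> l = 4" by auto
  then show ?case
    using assms(1,2) by (auto simp: preferred_orientation_def)
next
  case (step i)
  have orient: "diagram_orientation n a d"
    using assms(1) by (simp add: preferred_orientation_def)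
  have "d (Suc i) 0 l = d i (nat \<bar>a i\<bar>) l"
    using orient step.hyps step.prems unfolding diagram_orientation_def by auto
  also have "\<dots> = d i 0 (if even (a i) then l else swap_levels i l)"
    using orientation_in_box[OF orient, of i "nat \<bar>a i\<bar>" l] step.hyps step.prems
    by (simp add: even_nat_iff)
  also have "\<dots> = propagated c i (if even (a i) then l else swap_levels i l)"
    using step.prems by (intro step.IH) (auto simp: swap_levels_def upper_level_def)
  finally show ?case using c[of i] step.hyps step.prems by simp
qed

theorem theorem4p4:
  fixes p q :: int and n :: nat and a :: "nat \<Rightarrow> int"
    and d :: "nat \<Rightarrow> nat \<Rightarrow> nat \<Rightarrow> direction" and bs :: "(nat \<times> nat) list"
  assumes "n \<ge> 1"
    and "q \<noteq> 0" and "coprime p q"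
    and "of_int p / of_int q = cf_value (0 # map a [1..<Suc n])"
    and "nonalternating_form (0 # map a [1..<Suc n])"
    and "primitive_block_decomposition (0 # map a [1..<Suc n]) bs"
    and "\<forall>b\<in>set bs. \<not> exceptional_block (0 # map a [1..<Suc n]) b"
    and "preferred_orientation n a d"
  defines "\<epsilon> \<equiv> box_sign a d"
  shows "all_even_representation
           (0 # concat (map (replacement a \<epsilon> (tau a \<epsilon>)) [1..<Suc n])) (of_int p / of_int q)"
proof -
  define c where "c = 0 # map a [1..<Suc n]"
  have c0: "even (c ! 0)" by (simp add: c_def)
  have c: "c ! i = a i" if "i \<in> {1..n}" for i
    using that by (cases i) (auto simp: c_def simp del: upt_Suc)
  have "\<exists>s\<in>{1, -1}. \<forall>x\<in>set (map a [1..<Suc n]). sgn x = s"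
    using assms(5) unfolding nonalternating_form_def list.sel by blast
  then obtain s where s: "s = 1 \<or> s = -1" "\<forall>x\<in>set (map a [1..<Suc n]). sgn x = s"
    by blast
  then have sgn_a: "sgn (a i) = s" if "i \<in> {1..n}" for i
    using that by (auto simp del: upt_Suc)
  let ?P = "parallel_box c"
  \<comment> \<open>Here the block decomposition enters: every nonexceptional primitive block
    restores the directions of the left end.\<close>
  have final: "\<forall>l\<in>{1..4}. propagated c (Suc n) l = propagated c 0 l"
  proof (rule propagated_blocks)
    show "concat (map (\<lambda>(m, k). [m..<m + 2 * k + 1]) bs) = [0..<Suc n]"
      using assms(6) unfolding primitive_block_decomposition_def by simp
    show "\<forall>b\<in>set bs. primitive_block c b \<and> \<not> exceptional_block c b"
      using assms(6,7) by (simp add: primitive_block_decomposition_def c_def)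
  qed auto
  have level: "upper_level i \<in> {1..4}" "upper_level i + 1 \<in> {1..4}" for i
    by (auto simp: upper_level_def)
  have P_last: "\<not> ?P (Suc n)"
    using final level by (auto simp: parallel_box_def upper_level_def simp del: propagated.simps(2))
  \<comment> \<open>A parallel last box would leave the levels of box n + 1 swapped, against
    \<open>final\<close>.\<close>
  have "\<not> ?P n"
  proof
    assume "?P n"
    then have "propagated c (Suc n) l = propagated c 0 (swap_levels (Suc n) l)" if "l \<in> {1..4}" for l
      using propagated_phase[OF c0, of "Suc n"] P_last that by (simp add: phase_def)
    then show False
      using final level propagated_0_swap_levels by metis
  qed
  moreover have "\<not> ?P 0" "\<not> ?P 1"
    using c0 by (simp_all add: parallel_box_def upper_level_def)
  moreover have "?P (Suc i) \<longleftrightarrow> \<not> ?P i \<and> ?P (i - 1) \<noteq> odd (a i)" if "i \<in> {1..n}" for i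
    using parallel_box_Suc[OF c0, of i] c[OF that] that by simp
  \<comment> \<open>The handedness convention alternates with the parity of \<open>i\<close>, so an
    antiparallel box has sign \<open>s * (-1) ^ Suc i\<close>.\<close>
  moreover have "\<epsilon> i = s * (-1) ^ (if ?P i then i else Suc i)" if i: "i \<in> {1..n}" for i
  proof -
    have "d i 0 l = propagated c i l" if "l \<in> {1..4}" for l
      using preferred_orientation_eq_propagated[OF assms(8) c0 c] i that by simp
    then show ?thesis
      using level[of i] sgn_a[OF i]
      by (auto simp: \<epsilon>_def box_sign_def crossing_sign_def antiparallel_sign_def parallel_box_def)
  qed
  ultimately interpret oriented_vector n a \<epsilon> s ?P
    using assms(1) s(1) sgn_a P_last by unfold_locales
  show ?thesis unfolding assms(4) by (rule all_even_representation_tail)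
qed

end
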